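(* For every integer $n\geq 3$, writing $f_q(n)$ for the total number of occurrences of the pattern $q$ in all permutations of $S_n(123,132,312)$, we have $$f_{213}(n)=f_{231}(n)=\binom{n}{3},\qquad f_{321}(n)=(n-2)\binom{n}{3}.$$
   Context: $S_n$ is the set of permutations of $\{1,\dots,n\}$ written in one-line notation $\sigma=\sigma_1\sigma_2\cdots\sigma_n$. For $q\in S_k$, an occurrence of the pattern $q$ in $\sigma\in S_n$ is a choice of indices $i_1<i_2<\cdots<i_k$ in $\{1,\dots,n\}$ such that for all $1\le j,l\le k$, $q_j<q_l$ if and only if $\sigma_{i_j}<\sigma_{i_l}$. Let $f_q(\sigma)$ be the number of occurrences of $q$ in $\sigma$; $\sigma$ avoids $q$ if $f_q(\sigma)=0$. $S_n(123,132,312)$ is the set of permutations in $S_n$ avoiding all of $123$, $132$ and $312$, and $f_q(n)=\sum_{\sigma\in S_n(123,132,312)}f_q(\sigma)$. *)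

theory Defs
  imports "HOL-Combinatorics.Multiset_Permutations"
begin

text \<open>
  A permutation of \<open>{1..n}\<close> in one-line notation is a list in \<^term>\<open>permutations_of_set {1..n}\<close>.
  List indexing starts at 0, so positions of \<open>\<sigma>\<close> range over \<open>{..<length \<sigma>}\<close>; values range over \<open>{1..n}\<close>.
  The index tuple \<open>i\<^sub>1 < \<dots> < i\<^sub>k\<close> of an occurrence is a strictly increasing list.
\<close>

definition occurrences :: "nat list \<Rightarrow> nat list \<Rightarrow> nat list set" where
  "occurrences q \<sigma> =
     {is. length is = length q \<and> sorted_wrt (<) is \<and> set is \<subseteq> {..<length \<sigma>} \<and>
          (\<forall>j<length q. \<forall>l<length q. q ! j < q ! l \<longleftrightarrow> \<sigma> ! (is ! j) < \<sigma> ! (is ! l))}"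

lemma finite_occurrences: "finite (occurrences q \<sigma>)"
  by (rule finite_subset[OF _ finite_lists_length_eq[of "{..<length \<sigma>}" "length q"]])
     (auto simp: occurrences_def)

definition occ_count :: "nat list \<Rightarrow> nat list \<Rightarrow> nat" where
  "occ_count q \<sigma> = card (occurrences q \<sigma>)"

definition avoids :: "nat list \<Rightarrow> nat list \<Rightarrow> bool" where
  "avoids \<sigma> q \<longleftrightarrow> occ_count q \<sigma> = 0"

definition avoiders :: "nat \<Rightarrow> nat list set \<Rightarrow> nat list set" where
  "avoiders n Q = {\<sigma> \<in> permutations_of_set {1..n}. \<forall>q\<in>Q. avoids \<sigma> q}"

lemma finite_avoiders: "finite (avoiders n Q)"
  by (simp add: avoiders_def)

definition total_occ :: "nat list \<Rightarrow> nat \<Rightarrow> nat" where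
  "total_occ q n = (\<Sum>\<sigma>\<in>avoiders n {[1,2,3], [1,3,2], [3,1,2]}. occ_count q \<sigma>)"

end

theory Submission
  imports Defs
begin

text \<open>
  Let \<open>\<sigma>\<close> avoid 123, 132 and 312. An ascent before the entry \<open>n\<close> would give 123 with \<open>n\<close>,
  an ascent after it 312, and an ascent across it 132. Hence deleting \<open>n\<close> leaves a decreasing
  sequence, so the avoiders are the \<open>n\<close> words obtained by inserting \<open>n\<close> into
  \<open>(n-1)\<dots>1\<close>, and the ascents of such a word are exactly the pairs ending in \<open>n\<close>. With \<open>k\<close>
  entries in front of \<open>n\<close>, there are therefore \<open>k choose 2\<close> occurrences of 213,
  \<open>k * (n - 1 - k)\<close> of 231, and \<open>((n - 1) choose 3) + ((n - 1 - k) choose 2)\<close> of 321.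
\<close>

section \<open>Increasing index lists and occurrences of patterns of length three\<close>

definition inc_lists :: "nat \<Rightarrow> nat set \<Rightarrow> nat list set" where
  "inc_lists m A = {xs. length xs = m \<and> sorted_wrt (<) xs \<and> set xs \<subseteq> A}"

text \<open>A strictly increasing list is determined by its set of entries, so these lists
  correspond to the \<open>m\<close>-element subsets of \<open>A\<close>.\<close>

lemma card_inc_lists:
  assumes "finite A"
  shows "card (inc_lists m A) = card A choose m"
proof -
  have "bij_betw set (inc_lists m A) {B. B \<subseteq> A \<and> card B = m}"
  proof (rule bij_betw_byWitness[where f' = sorted_list_of_set])
    show "\<forall>xs\<in>inc_lists m A. sorted_list_of_set (set xs) = xs"
      by (auto simp: inc_lists_def strict_sorted_iff sorted_list_of_set.idem_if_sorted_distinct)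
    show "\<forall>B\<in>{B. B \<subseteq> A \<and> card B = m}. set (sorted_list_of_set B) = B"
      using assms by (auto dest: finite_subset)
    show "set ` inc_lists m A \<subseteq> {B. B \<subseteq> A \<and> card B = m}"
      by (auto simp: inc_lists_def strict_sorted_iff distinct_card)
    show "sorted_list_of_set ` {B. B \<subseteq> A \<and> card B = m} \<subseteq> inc_lists m A"
      using finite_subset[OF _ assms] by (auto simp: inc_lists_def)
  qed
  then show ?thesis
    using n_subsets[OF assms] by (simp add: bij_betw_same_card)
qed

lemma inc_lists_2: "inc_lists 2 A = {[i, j] | i j. i < j \<and> i \<in> A \<and> j \<in> A}"
  by (auto simp: inc_lists_def length_Suc_conv numeral_2_eq_2)

lemma inc_lists_3:
  "inc_lists 3 A = {[i, j, l] | i j l. i < j \<and> j < l \<and> i \<in> A \<and> j \<in> A \<and> l \<in> A}"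
  by (auto simp: inc_lists_def length_Suc_conv numeral_3_eq_3)

text \<open>Of the nine index pairs the three diagonal ones say nothing. Both directions of the
  other six are kept because \<open>a\<close>, \<open>b\<close>, \<open>c\<close> may
  coincide.\<close>

lemma occurrences_3:
  "occurrences [a, b, c] \<sigma> =
     {[i, j, l] | i j l. i < j \<and> j < l \<and> l < length \<sigma> \<and>
        (a < b \<longleftrightarrow> \<sigma> ! i < \<sigma> ! j) \<and> (b < a \<longleftrightarrow> \<sigma> ! j < \<sigma> ! i) \<and>
        (a < c \<longleftrightarrow> \<sigma> ! i < \<sigma> ! l) \<and> (c < a \<longleftrightarrow> \<sigma> ! l < \<sigma> ! i) \<and>
        (b < c \<longleftrightarrow> \<sigma> ! j < \<sigma> ! l) \<and> (c < b \<longleftrightarrow> \<sigma> ! l < \<sigma> ! j)}"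
  (is "_ = {[i, j, l] | i j l. i < j \<and> j < l \<and> l < length \<sigma> \<and> ?P i j l}")
proof -
  have mem: "[i, j, l] \<in> occurrences [a, b, c] \<sigma> \<longleftrightarrow>
      i < j \<and> j < l \<and> l < length \<sigma> \<and> ?P i j l" for i j l
  proof -
    have "(\<forall>u<length [a, b, c]. \<forall>v<length [a, b, c].
        [a, b, c] ! u < [a, b, c] ! v \<longleftrightarrow> \<sigma> ! ([i, j, l] ! u) < \<sigma> ! ([i, j, l] ! v)) \<longleftrightarrow> ?P i j l"
      by (simp add: All_less_Suc2 conj_ac)
    \<comment> \<open>An arbitrary \<open>Q\<close> keeps the quantified pattern condition in one
      piece, so that the previous fact can rewrite it.\<close>
    moreover have "length [i, j, l] = length [a, b, c] \<and> sorted_wrt (<) [i, j, l] \<and>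
        set [i, j, l] \<subseteq> {..<length \<sigma>} \<and> Q \<longleftrightarrow> i < j \<and> j < l \<and> l < length \<sigma> \<and> Q" for Q
      by auto
    ultimately show ?thesis
      by (simp only: occurrences_def mem_Collect_eq)
  qed
  have ex: "\<exists>i j l. is = [i, j, l]" if "is \<in> occurrences [a, b, c] \<sigma>" for "is"
    using that by (auto simp: occurrences_def length_Suc_conv)
  show ?thesis
  proof (intro set_eqI iffI)
    fix "is" assume *: "is \<in> occurrences [a, b, c] \<sigma>"
    with ex obtain i j l where "is = [i, j, l]" by blast
    with * show "is \<in> {[i, j, l] | i j l. i < j \<and> j < l \<and> l < length \<sigma> \<and> ?P i j l}"
      by (simp add: mem)
  next
    fix "is" assume "is \<in> {[i, j, l] | i j l. i < j \<and> j < l \<and> l < length \<sigma> \<and> ?P i j l}"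
    then show "is \<in> occurrences [a, b, c] \<sigma>"
      by (elim CollectE exE conjE) (simp add: mem)
  qed
qed

lemma avoids_iff: "avoids \<sigma> q \<longleftrightarrow> occurrences q \<sigma> = {}"
  by (simp add: avoids_def occ_count_def finite_occurrences)

section \<open>The decreasing word with its maximum inserted at position \<open>k\<close>\<close>

definition insert_max :: "nat \<Rightarrow> nat \<Rightarrow> nat list" where
  "insert_max n k = take k (rev [1..<n]) @ n # drop k (rev [1..<n])"

lemma length_insert_max: "k < n \<Longrightarrow> length (insert_max n k) = n"
  by (simp add: insert_max_def)

text \<open>Entry \<open>p\<close> of \<open>rev [1..<n]\<close> is \<open>n - 1 - p\<close>; behind
  the inserted maximum, index \<open>i\<close> reads entry \<open>i - 1\<close>.\<close>

lemma nth_insert_max: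
  assumes "k < n" "i < n"
  shows "insert_max n k ! i = (if i < k then n - 1 - i else if i = k then n else n - i)"
  using assms by (auto simp: insert_max_def nth_append rev_nth nth_Cons')

text \<open>Comparing two entries only asks whether the later position is \<open>k\<close>. This
  turns every pattern condition into one on positions alone.\<close>

lemma insert_max_less_iff:
  assumes "k < n" "i < j" "j < n"
  shows "insert_max n k ! i < insert_max n k ! j \<longleftrightarrow> j = k"
    and "insert_max n k ! j < insert_max n k ! i \<longleftrightarrow> j \<noteq> k"
  using assms by (auto simp: nth_insert_max)

text \<open>The position of \<open>n\<close> recovers \<open>k\<close>, since all other entries are
  smaller.\<close>

lemma inj_on_insert_max: "inj_on (insert_max n) {..<n}"
proof (rule inj_onI)
  fix k k' assume *: "k \<in> {..<n}" "k' \<in> {..<n}" "insert_max n k = insert_max n k'"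
  then have "insert_max n k' ! k = n"
    using nth_insert_max[of k n k] by simp
  with * show "k = k'"
    using nth_insert_max[of k' n k] by (auto split: if_splits)
qed

lemma occurrences_insert_max:
  assumes "k < n"
  shows "occurrences [a, b, c] (insert_max n k) =
     {[i, j, l] | i j l. i < j \<and> j < l \<and> l < n \<and>
        (a < b \<longleftrightarrow> j = k) \<and> (b < a \<longleftrightarrow> j \<noteq> k) \<and>
        (a < c \<longleftrightarrow> l = k) \<and> (c < a \<longleftrightarrow> l \<noteq> k) \<and>
        (b < c \<longleftrightarrow> l = k) \<and> (c < b \<longleftrightarrow> l \<noteq> k)}"
  unfolding occurrences_3 length_insert_max[OF assms]
  by (simp add: insert_max_less_iff[OF assms] cong: conj_cong)

lemma insert_max_permutation:
  assumes "k < n"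
  shows "insert_max n k \<in> permutations_of_set {1..n}"
proof -
  have "mset (insert_max n k) = add_mset n (mset (take k (rev [1..<n]) @ drop k (rev [1..<n])))"
    by (simp only: insert_max_def mset_append mset.simps union_mset_add_mset_right)
  also have "\<dots> = mset [1..<Suc n]"
    unfolding append_take_drop_id mset_rev using assms by simp
  finally have *: "mset (insert_max n k) = mset [1..<Suc n]" .
  show ?thesis
  proof (rule permutations_of_setI)
    show "set (insert_max n k) = {1..n}"
      unfolding mset_eq_setD[OF *] set_upt by (rule atLeastLessThanSuc_atLeastAtMost)
    show "distinct (insert_max n k)"
      unfolding mset_eq_imp_distinct_iff[OF *] by (rule distinct_upt)
  qed
qed

section \<open>Classification of the avoiders\<close>

lemma insert_max_avoider:
  assumes "k < n"
  shows "insert_max n k \<in> avoiders n {[1,2,3], [1,3,2], [3,1,2]}"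
  using insert_max_permutation[OF assms]
  \<comment> \<open>Ascents end only at position \<open>k\<close>. But 123 and 132 have ascents
    ending at two positions, and the last entry of 312 ends both an ascent and a descent.\<close>
  by (auto simp: avoiders_def avoids_iff occurrences_insert_max[OF assms])

lemma avoider_is_insert_max:
  assumes "n > 0" and "\<sigma> \<in> avoiders n {[1,2,3], [1,3,2], [3,1,2]}"
  shows "\<exists>k<n. \<sigma> = insert_max n k"
proof -
  from assms(2) have set_\<sigma>: "set \<sigma> = {1..n}" and dist: "distinct \<sigma>"
    and no: "occurrences [1,2,3] \<sigma> = {}" "occurrences [1,3,2] \<sigma> = {}"
      "occurrences [3,1,2] \<sigma> = {}"
    by (auto simp: avoiders_def avoids_iff permutations_of_set_def)
  from \<open>n > 0\<close> set_\<sigma> have "n \<in> set \<sigma>" by simp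
  then obtain A B where \<sigma>: "\<sigma> = A @ n # B"
    by (meson split_list)
  have "set (A @ B) = set \<sigma> - {n}" and "distinct (A @ B)"
    using dist unfolding \<sigma> by auto
  then have AB: "set (A @ B) = {1..<n}" "distinct (A @ B)"
    unfolding set_\<sigma> by auto
  then have less_n: "x < n" if "x \<in> set A \<union> set B" for x
    using that by auto
  have neq: "x \<noteq> y" if "x \<in> set A" "y \<in> set B" for x y
    using AB(2) that by auto
  have "A ! j < A ! i" if "i < j" "j < length A" for i j
  proof (rule ccontr)
    assume "\<not> A ! j < A ! i"
    with that AB(2) have "A ! i < A ! j"
      by (simp add: nth_eq_iff_index_eq le_neq_trans not_less)
    moreover have "A ! j < n" using that less_n by simp
    \<comment> \<open>In \<open>\<sigma>\<close> the maximum stands at position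
      \<open>length A\<close>, and \<open>B ! j\<close> at
      \<open>Suc (length A + j)\<close>.\<close>
    ultimately have "[i, j, length A] \<in> occurrences [1,2,3] \<sigma>"
      using that by (auto simp: occurrences_3 \<sigma> nth_append)
    with no show False by blast
  qed
  then have dec_A: "sorted_wrt (>) A"
    by (simp add: sorted_wrt_iff_nth_less)
  have "B ! j < B ! i" if "i < j" "j < length B" for i j
  proof (rule ccontr)
    assume "\<not> B ! j < B ! i"
    with that AB(2) have "B ! i < B ! j"
      by (simp add: nth_eq_iff_index_eq le_neq_trans not_less)
    moreover have "B ! j < n" using that less_n by simp
    ultimately have "[length A, Suc (length A + i), Suc (length A + j)] \<in> occurrences [3,1,2] \<sigma>"
      using that by (auto simp: occurrences_3 \<sigma> nth_append)
    with no show False by blast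
  qed
  then have dec_B: "sorted_wrt (>) B"
    by (simp add: sorted_wrt_iff_nth_less)
  have "B ! j < A ! i" if "i < length A" "j < length B" for i j
  proof (rule ccontr)
    assume "\<not> B ! j < A ! i"
    with neq[of "A ! i" "B ! j"] that have "A ! i < B ! j" by simp
    moreover have "B ! j < n" using that less_n by simp
    ultimately have "[i, length A, Suc (length A + j)] \<in> occurrences [1,3,2] \<sigma>"
      using that by (auto simp: occurrences_3 \<sigma> nth_append)
    with no show False by blast
  qed
  then have "\<forall>x\<in>set A. \<forall>y\<in>set B. x > y"
    by (auto simp: in_set_conv_nth)
  with dec_A dec_B have "sorted_wrt (>) (A @ B)"
    by (simp add: sorted_wrt_append)
  then have "sorted_wrt (<) (rev (A @ B))"
    by (simp only: sorted_wrt_rev)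
  moreover have "set (rev (A @ B)) = set [1..<n]"
    using AB(1) by (simp add: Un_commute)
  \<comment> \<open>A strictly increasing list is determined by its set; hence the reversal.\<close>
  ultimately have "rev (A @ B) = [1..<n]"
    by (intro strict_sorted_equal) auto
  then have eq: "A @ B = rev [1..<n]"
    by (metis rev_rev_ident)
  then have "A = take (length A) (rev [1..<n])" "B = drop (length A) (rev [1..<n])"
    by (metis append_eq_conv_conj)+
  then have "\<sigma> = insert_max n (length A)"
    by (simp add: \<sigma> insert_max_def)
  moreover from arg_cong[OF eq, of length] \<open>n > 0\<close> have "length A < n"
    by simp
  ultimately show ?thesis by blast
qed

lemma total_occ_eq_sum:
  assumes "n > 0"
  shows "total_occ q n = (\<Sum>k<n. occ_count q (insert_max n k))"
proof -
  have "avoiders n {[1,2,3], [1,3,2], [3,1,2]} = insert_max n ` {..<n}"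
    using avoider_is_insert_max[OF assms] insert_max_avoider by auto
  then show ?thesis
    by (simp add: total_occ_def sum.reindex[OF inj_on_insert_max])
qed

section \<open>Occurrences in a single avoider\<close>

lemma occ_count_213:
  assumes "k < n"
  shows "occ_count [2,1,3] (insert_max n k) = k choose 2"
proof -
  \<comment> \<open>The 3 ends ascents, so it sits at \<open>k\<close>; any two earlier positions
    form the descent 21.\<close>
  have "occurrences [2,1,3] (insert_max n k) = (\<lambda>xs. xs @ [k]) ` inc_lists 2 {..<k}"
    unfolding occurrences_insert_max[OF assms] inc_lists_2 using assms
    by (auto simp: image_iff)
  then show ?thesis
    by (simp add: occ_count_def card_image inj_on_def card_inc_lists)
qed

lemma occ_count_231:
  assumes "k < n"
  shows "occ_count [2,3,1] (insert_max n k) = k * (n - 1 - k)"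
proof -
  \<comment> \<open>The 3 ends the ascent, so it sits at \<open>k\<close>, with the 2 anywhere
    before and the 1 anywhere behind.\<close>
  have "occurrences [2,3,1] (insert_max n k) = (\<lambda>(i, l). [i, k, l]) ` ({..<k} \<times> {k<..<n})"
    unfolding occurrences_insert_max[OF assms] by (auto simp: image_iff)
  then show ?thesis
    by (simp add: occ_count_def card_image inj_on_def)
qed

lemma occ_count_321:
  assumes "k < n"
  shows "occ_count [3,2,1] (insert_max n k) = ((n - 1) choose 3) + ((n - 1 - k) choose 2)"
proof -
  \<comment> \<open>Position \<open>k\<close> ends no descent, so an occurrence either misses
    \<open>k\<close> or starts there.\<close>
  have "occurrences [3,2,1] (insert_max n k) =
      inc_lists 3 ({..<n} - {k}) \<union> (#) k ` inc_lists 2 {k<..<n}"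
    unfolding occurrences_insert_max[OF assms] inc_lists_2 inc_lists_3
    by (auto simp: image_iff)
  moreover have "inc_lists 3 ({..<n} - {k}) \<inter> (#) k ` inc_lists 2 {k<..<n} = {}"
    by (auto simp: inc_lists_def)
  moreover have "finite (inc_lists m A)" if "finite A" for m A
    by (rule finite_subset[OF _ finite_lists_length_eq[OF that, of m]])
       (auto simp: inc_lists_def)
  ultimately show ?thesis
    using assms by (simp add: occ_count_def card_Un_disjoint card_image card_inc_lists)
qed

section \<open>The hockey-stick identity, and triples counted by their middle element\<close>

lemma sum_choose_lessThan: "(\<Sum>k<n. k choose m) = n choose Suc m"
  by (induction n) auto

lemma sum_mult_diff: "(\<Sum>k<n. k * (n - 1 - k)) = n choose 3"
proof (induction n)
  case (Suc n)
  \<comment> \<open>Each old summand grows by \<open>k\<close> and the new one,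
    \<open>k = n\<close>, is 0; Pascal's rule then closes the induction.\<close>
  have "k * (Suc n - 1 - k) = k * (n - 1 - k) + k" if "k < n" for k
    using that by (cases n) (simp_all add: Suc_diff_le)
  then have "(\<Sum>k<Suc n. k * (Suc n - 1 - k)) = (\<Sum>k<n. k * (n - 1 - k) + k)"
    by simp
  also have "\<dots> = (n choose 3) + (n choose 2)"
    using Suc.IH sum_choose_lessThan[of 1 n]
    by (simp add: sum.distrib numeral_2_eq_2)
  finally show ?case
    by (simp add: numeral_3_eq_3 numeral_2_eq_2)
qed simp

theorem theorem3p7:
  fixes n :: nat
  assumes "n \<ge> 3"
  shows "total_occ [2,1,3] n = n choose 3 \<and>
         total_occ [2,3,1] n = n choose 3 \<and>
         total_occ [3,2,1] n = (n - 2) * (n choose 3)"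
proof (intro conjI)
  from assms have n: "n > 0" by simp
  have choose2: "(\<Sum>k<n. k choose 2) = n choose 3"
    using sum_choose_lessThan[of 2 n] by (simp add: numeral_3_eq_3 numeral_2_eq_2)
  show "total_occ [2,1,3] n = n choose 3"
    by (simp add: total_occ_eq_sum[OF n] occ_count_213 choose2 del: One_nat_def)
  show "total_occ [2,3,1] n = n choose 3"
    using sum_mult_diff by (simp add: total_occ_eq_sum[OF n] occ_count_231 del: One_nat_def)
  \<comment> \<open>The reflection of \<open>k\<close> to \<open>n - 1 - k\<close> permutes the
    range of summation.\<close>
  have "(\<Sum>k<n. (n - 1 - k) choose 2) = n choose 3"
    using sum.nat_diff_reindex[of "\<lambda>k. k choose 2" n] choose2 by simp
  then have "total_occ [3,2,1] n = n * ((n - 1) choose 3) + (n choose 3)"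
    by (simp add: total_occ_eq_sum[OF n] occ_count_321 sum.distrib del: One_nat_def)
  \<comment> \<open>Both sides count 3-subsets together with a marked element outside.\<close>
  also have "n * ((n - 1) choose 3) = (n - 3) * (n choose 3)"
    using binomial_absorb_comp[of n 3] by simp
  also have "(n - 3) * (n choose 3) + (n choose 3) = Suc (n - 3) * (n choose 3)"
    by simp
  \<comment> \<open>Subtraction is truncated, so this fails for \<open>n < 3\<close>.\<close>
  also have "Suc (n - 3) = n - 2"
    using assms by simp
  finally show "total_occ [3,2,1] n = (n - 2) * (n choose 3)" .
qed

end
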